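(* Consider the causal adversarial multi-path network model with passive feedback described in the context, with $C$ unit-capacity links, additive jamming, and no secrecy requirement. For any $\vec z=(z_{rw},z_{ro},z_{wo})$ with $z_{rw}+z_{ro}+z_{wo}\le C$, writing $z_r=z_{rw}+z_{ro}$ and $z_w=z_{rw}+z_{wo}$, the capacity is $$R=\begin{cases} 0 & \text{if } z_r=C \text{ and } C\le 2z_w,\\ C-z_w & \text{otherwise.}\end{cases}$$
   Context: Model. A sender (Alice) communicates with a receiver (Bob) over $C$ parallel directed noiseless links $L_1,\dots,L_C$, each of unit capacity (large-alphabet regime). A code of block length $n$ and rate $R$ has message $M$ uniform on $\{0,1\}^{nR}$ and uses private randomness of Alice unknown to the adversary. Passive feedback: the code may operate in $r\ge1$ rounds of lengths $n^{(1)},\dots,n^{(r)}$ summing to $n$; in round $k$ Alice sends codewords $\vec X^{(k)}_1,\dots,\vec X^{(k)}_C$ which are functions of the message, her randomness, and all words $\vec Y^{(1)},\dots,\vec Y^{(k-1)}$ received by Bob in earlier rounds (Alice observes everything Bob receives, causally). Bob decodes $\hat M$ from all received words. Adversary. Calvin, who knows the coding scheme, selects pairwise disjoint link sets $Z_{rw},Z_{ro},Z_{wo}$ (unknown to Alice and Bob) with $|Z_{rw}|\le z_{rw}$, $|Z_{ro}|\le z_{ro}$, $|Z_{wo}|\le z_{wo}$; he reads the links in $Z_r=Z_{rw}\cup Z_{ro}$ and jams the links in $Z_w=Z_{rw}\cup Z_{wo}$. He is causal: his jamming of the symbols at time $t$ may depend only on symbols observed on $Z_r$ up to and including time $t$.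 Under additive jamming $\vec Y_i=\vec X_i+\vec E_i$ with $\vec E_i$ chosen by Calvin and $\vec E_i=0$ for $i\notin Z_w$ (so on links of $Z_{wo}$ Calvin does not learn the received symbols); under overwrite jamming $\vec Y_i=\vec E_i$ for $i\in Z_w$ and $\vec Y_i=\vec X_i$ otherwise. Rate $R$ is achievable if for every $\varepsilon>0$ and all sufficiently large $n$ there is such a code with $\Pr[\hat M\ne M]<\varepsilon$ against every admissible causal adversary; the capacity is the supremum of achievable rates. *)

theory Defs
  imports "HOL-Probability.Probability"
begin

text \<open>
Conventions.  Links are indexed by 0..<C, time steps by 0..<n.  A word array
Y :: nat => nat => nat maps (time s, link i) to the symbol in Z_q (values 0..<q).
Round lengths are given by a nonempty list ns with sum n; rstart ns t is the
starting time of the round containing time t.  Alice's private randomness is a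
discrete distribution W :: nat pmf.  The adversary is deterministic (randomised
adversaries are mixtures of deterministic ones, so this loses nothing).
\<close>

definition trunc :: "nat \<Rightarrow> (nat \<Rightarrow> nat \<Rightarrow> nat) \<Rightarrow> (nat \<Rightarrow> nat \<Rightarrow> nat)" where
  "trunc k Y = (\<lambda>s i. if s < k then Y s i else 0)"

definition rstart :: "nat list \<Rightarrow> nat \<Rightarrow> nat" where
  "rstart ns t = Max {sum_list (take k ns) | k. k \<le> length ns \<and> sum_list (take k ns) \<le> t}"

definition xsym :: "nat \<Rightarrow> (nat \<Rightarrow> nat \<Rightarrow> (nat \<Rightarrow> nat \<Rightarrow> nat) \<Rightarrow> nat \<Rightarrow> nat \<Rightarrow> nat)
    \<Rightarrow> nat list \<Rightarrow> nat \<Rightarrow> nat \<Rightarrow> (nat \<Rightarrow> nat \<Rightarrow> nat) \<Rightarrow> nat \<Rightarrow> nat \<Rightarrow> nat" where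
  "xsym q enc ns m w Y s i = enc m w (trunc (rstart ns s) Y) s i mod q"

text \<open>Received array after the first t time steps (entries at times \<ge> t and
links \<ge> C are 0), under additive causal jamming.  At time t Calvin sees the
transmitted symbols on links in Zr at times \<le> t and adds adv t obs i on links
i in Zw.\<close>
fun run :: "nat \<Rightarrow> nat \<Rightarrow> (nat \<Rightarrow> nat \<Rightarrow> (nat \<Rightarrow> nat \<Rightarrow> nat) \<Rightarrow> nat \<Rightarrow> nat \<Rightarrow> nat)
    \<Rightarrow> nat list \<Rightarrow> nat set \<Rightarrow> nat set \<Rightarrow> (nat \<Rightarrow> (nat \<Rightarrow> nat \<Rightarrow> nat) \<Rightarrow> nat \<Rightarrow> nat)
    \<Rightarrow> nat \<Rightarrow> nat \<Rightarrow> nat \<Rightarrow> (nat \<Rightarrow> nat \<Rightarrow> nat)" where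
  "run q C enc ns Zr Zw adv m w 0 = (\<lambda>s i. 0)"
| "run q C enc ns Zr Zw adv m w (Suc t) =
     (let Y = run q C enc ns Zr Zw adv m w t;
          obs = (\<lambda>s j. if s \<le> t \<and> j \<in> Zr then xsym q enc ns m w Y s j else 0);
          E = (\<lambda>i. if i \<in> Zw then adv t obs i else 0)
      in (\<lambda>s i. if s = t \<and> i < C then (xsym q enc ns m w Y t i + E i) mod q else Y s i))"

definition err_prob where
  "err_prob q C n ns K enc dec W Zr Zw adv =
     (\<Sum>m<K. measure_pmf.prob W {w. dec (run q C enc ns Zr Zw adv m w n) \<noteq> m}) / real K"

definition admissible_sets :: "nat \<Rightarrow> nat \<Rightarrow> nat \<Rightarrow> nat \<Rightarrow> nat set \<Rightarrow> nat set \<Rightarrow> nat set \<Rightarrow> bool" where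
  "admissible_sets C zrw zro zwo Zrw Zro Zwo \<longleftrightarrow>
     Zrw \<union> Zro \<union> Zwo \<subseteq> {..<C} \<and>
     Zrw \<inter> Zro = {} \<and> Zrw \<inter> Zwo = {} \<and> Zro \<inter> Zwo = {} \<and>
     card Zrw \<le> zrw \<and> card Zro \<le> zro \<and> card Zwo \<le> zwo"

text \<open>Rate R (in units of log q per link use, i.e. unit-capacity links) with
alphabet Z_q, q chosen by the code designer (large-alphabet regime).\<close>
definition achievable :: "nat \<Rightarrow> nat \<Rightarrow> nat \<Rightarrow> nat \<Rightarrow> real \<Rightarrow> bool" where
  "achievable C zrw zro zwo R \<longleftrightarrow>
     (\<forall>\<epsilon>>0. \<exists>N. \<forall>n\<ge>N. \<exists>q::nat. q \<ge> 2 \<and>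
        (\<exists>ns enc dec W. ns \<noteq> [] \<and> sum_list ns = n \<and>
          (\<forall>Zrw Zro Zwo adv. admissible_sets C zrw zro zwo Zrw Zro Zwo \<longrightarrow>
             err_prob q C n ns (nat \<lceil>real q powr (real n * R)\<rceil>) enc dec W
               (Zrw \<union> Zro) (Zrw \<union> Zwo) adv < \<epsilon>)))"

definition capacity :: "nat \<Rightarrow> nat \<Rightarrow> nat \<Rightarrow> nat \<Rightarrow> real" where
  "capacity C zrw zro zwo = Sup {R. achievable C zrw zro zwo R}"

end

theory Submission
  imports Defs "HOL-Computational_Algebra.Polynomial" "HOL-Computational_Algebra.Primes"
begin

text \<open>
  Converse. If Calvin adds uniform noise on \<open>z\<^sub>w\<close> links, these links carry no information, so rates
  above \<open>C - z\<^sub>w\<close> fail. If he reads all links and \<open>C \<le> 2 z\<^sub>w\<close>, he simulates Alice with an independent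
  message on half of the links; Bob cannot tell which half is genuine.

  Achievability. Alice sends the payload with a Reed-Solomon code of dimension \<open>k = C - z\<^sub>w\<close> across
  the links. By feedback she knows the set of jammed links; once Bob learns this set, he decodes the
  erasures. Only the set, one of \<open>2\<^sup>C\<close> values, has to be conveyed reliably in the last time step.
  If \<open>2 z\<^sub>w < C\<close>, she sends it on all links and Bob takes the majority. If some link is not read, she
  first sends \<open>2\<^sup>C\<close> random symbols on every link; the sums over the links of the symbols received are
  keys shared with Bob, uniform for Calvin since jamming is additive. She then announces the set
  number \<open>d\<close> by sending the key number \<open>d\<close> on all links. Some link is not jammed, and imitating a different set
  means guessing an unseen key, which succeeds with probability \<open>O(1/q)\<close>.
\<close>

section \<open>Causal runs\<close>

lemma rstart_le: "rstart ns t \<le> t"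
proof -
  let ?S = "{sum_list (take k ns) | k. k \<le> length ns \<and> sum_list (take k ns) \<le> t}"
  have "finite ?S" by (rule finite_subset[of _ "{..t}"]) auto
  moreover have "sum_list (take 0 ns) \<in> ?S" by fastforce
  ultimately have "Max ?S \<in> ?S" by (intro Max_in) auto
  then show ?thesis unfolding rstart_def by auto
qed

lemma run_beyond: "s \<ge> t \<or> i \<ge> C \<Longrightarrow> run q C enc ns Zr Zw adv m w t s i = 0"
  by (induction t) (auto simp: Let_def)

lemma run_lt: "q > 0 \<Longrightarrow> run q C enc ns Zr Zw adv m w t s i < q"
  by (induction t) (auto simp: Let_def)

text \<open>Step \<open>t\<close> writes only row \<open>t\<close>, so continuing the run leaves
  earlier rows untouched.\<close>

lemma trunc_run:
  "k \<le> t \<Longrightarrow> trunc k (run q C enc ns Zr Zw adv m w t) = run q C enc ns Zr Zw adv m w k"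
proof (induction t rule: dec_induct)
  case base
  show ?case by (intro ext) (auto simp: trunc_def run_beyond)
next
  case (step t)
  have "trunc k (run q C enc ns Zr Zw adv m w (Suc t)) = trunc k (run q C enc ns Zr Zw adv m w t)"
    using step.hyps by (intro ext) (auto simp: trunc_def Let_def)
  then show ?case using step by simp
qed

lemma xsym_run:
  assumes "s \<le> t"
  shows "xsym q enc ns m w (run q C enc ns Zr Zw adv m w t) s i
    = enc m w (run q C enc ns Zr Zw adv m w (rstart ns s)) s i mod q"
  using trunc_run[of "rstart ns s" t] rstart_le[of ns s] assms by (simp add: xsym_def)

text \<open>Calvin's summand at time \<open>t\<close>. Stopping the run at \<open>t\<close>
  suffices, because symbols sent by time \<open>t\<close> depend only on feedback from before
  \<open>t\<close>.\<close>

definition noise where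
  "noise q C enc ns Zr Zw adv m w t i = (if i \<in> Zw then adv t (\<lambda>s j. if s \<le> t \<and> j \<in> Zr
       then xsym q enc ns m w (run q C enc ns Zr Zw adv m w t) s j else 0) i else 0)"

lemma run_nth:
  assumes "s < t" "i < C"
  shows "run q C enc ns Zr Zw adv m w t s i
    = (xsym q enc ns m w (run q C enc ns Zr Zw adv m w t) s i
        + noise q C enc ns Zr Zw adv m w s i) mod q"
proof -
  have "run q C enc ns Zr Zw adv m w t s i = run q C enc ns Zr Zw adv m w (Suc s) s i"
    using trunc_run[of "Suc s" t q C enc ns Zr Zw adv m w] assms
    by (metis Suc_leI lessI trunc_def)
  then show ?thesis
    using assms by (simp add: Let_def noise_def xsym_run)
qed

section \<open>Tools for probabilities and residues\<close>

text \<open>The sum of the probabilities is the expected number of events that occur, and this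
  number is bounded pointwise.\<close>

lemma sum_prob_le:
  fixes W :: "'a pmf"
  assumes "finite I" and "\<And>w. real (card {i \<in> I. w \<in> A i}) \<le> B"
  shows "(\<Sum>i\<in>I. measure_pmf.prob W (A i)) \<le> B"
proof -
  have "(\<Sum>i\<in>I. measure_pmf.prob W (A i)) = measure_pmf.expectation W (\<lambda>w. \<Sum>i\<in>I. indicator (A i) w)"
    by (subst Bochner_Integration.integral_sum) (auto intro: measure_pmf.integrable_const_bound[where B = 1])
  also have "(\<lambda>w. \<Sum>i\<in>I. indicator (A i) w) = (\<lambda>w. real (card {i \<in> I. w \<in> A i}))"
    using assms(1) by (intro ext) (simp add: indicator_def sum.If_cases Int_def)
  also have "measure_pmf.expectation W (\<lambda>w. real (card {i \<in> I. w \<in> A i})) \<le> B"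
    using assms
    by (intro measure_pmf.integral_le_const measure_pmf.integrable_const_bound[where B = "real (card I)"])
      (auto intro!: card_mono)
  finally show ?thesis .
qed

lemma prob_pair_pmf:
  "measure_pmf.prob (pair_pmf V W) S = measure_pmf.expectation V (\<lambda>v. measure_pmf.prob W {w. (v, w) \<in> S})"
proof -
  have "ennreal (measure_pmf.prob (pair_pmf V W) S) = (\<integral>\<^sup>+x. indicator S x \<partial>pair_pmf V W)"
    by (simp add: measure_pmf.emeasure_eq_measure)
  also have "\<dots> = (\<integral>\<^sup>+v. \<integral>\<^sup>+w. indicator {w. (v, w) \<in> S} w \<partial>W \<partial>V)"
    by (simp add: nn_integral_pair_pmf' indicator_def)
  also have "\<dots> = (\<integral>\<^sup>+v. ennreal (measure_pmf.prob W {w. (v, w) \<in> S}) \<partial>V)"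
    by (simp add: measure_pmf.emeasure_eq_measure)
  also have "\<dots> = ennreal (measure_pmf.expectation V (\<lambda>v. measure_pmf.prob W {w. (v, w) \<in> S}))"
    by (intro nn_integral_eq_integral measure_pmf.integrable_const_bound[where B = 1]) auto
  finally show ?thesis by (subst (asm) ennreal_inj) auto
qed

lemma add_left_mod_cancel:
  fixes a b q x :: nat
  assumes "a < q" "b < q" "(x + a) mod q = (x + b) mod q"
  shows "a = b"
  using assms
proof (induction a b rule: linorder_wlog)
  case (le a b)
  then have "q dvd b - a"
    using mod_eq_dvd_iff_nat[of "x + a" "x + b" q] by simp
  then have "b - a = 0" using le by (metis less_imp_diff_less nat_dvd_not_less neq0_conv)
  then show ?case using le by simp
qed simp

section \<open>Converse for rates above the number of unjammed links\<close>

text \<open>For fixed \<open>w\<close>, the received array determines a correctly decoded \<open>m\<close>, hence the sent symbols,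
  hence the noise \<open>e\<close>. So correct pairs inject into received arrays.\<close>

lemma random_noise_success_le:
  fixes n :: nat
  assumes q: "q > 0" and Zw: "Zw \<subseteq> {..<C}"
  defines "E \<equiv> PiE ({..<n} \<times> Zw) (\<lambda>_. {..<q})"
  shows "card {(m, e). m < K \<and> e \<in> E \<and> dec (run q C enc ns Zr Zw (\<lambda>t obs i. e (t, i)) m w n) = m}
           \<le> q ^ (C * n)"
proof -
  define r where "r = (\<lambda>(m, e :: nat \<times> nat \<Rightarrow> nat). run q C enc ns Zr Zw (\<lambda>t obs i. e (t, i)) m w n)"
  define G where "G = {(m, e). m < K \<and> e \<in> E \<and> dec (r (m, e)) = m}"
  define F where "F = PiE ({..<n} \<times> {..<C}) (\<lambda>_. {..<q})"
  define h where "h = (\<lambda>x. restrict (\<lambda>(s, i). r x s i) ({..<n} \<times> {..<C}))"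
  have "inj_on h G"
  proof (rule inj_onI)
    fix x y assume "x \<in> G" "y \<in> G" and hxy: "h x = h y"
    then obtain m e m' e' where x: "x = (m, e)" "e \<in> E" "dec (r x) = m"
      and y: "y = (m', e')" "e' \<in> E" "dec (r y) = m'"
      unfolding G_def by auto
    have rxy: "r x = r y"
    proof (intro ext)
      fix s i
      show "r x s i = r y s i"
      proof (cases "s < n \<and> i < C")
        case True
        then show ?thesis using fun_cong[OF hxy, of "(s, i)"] by (simp add: h_def)
      next
        case False
        then have "s \<ge> n \<or> i \<ge> C" by auto
        then show ?thesis by (simp add: r_def x(1) y(1) run_beyond)
      qed
    qed
    then have m: "m = m'" using x y by simp
    \<comment> \<open>Equal messages and equal feedback give equal sent symbols, so the received
      symbol reveals the noise.\<close>
    have "e (t, i) = e' (t, i)" if ti: "t < n" "i \<in> Zw" for t i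
    proof -
      have iC: "i < C" using ti Zw by auto
      let ?X = "xsym q enc ns m w (r x) t i"
      have "r x t i = (?X + e (t, i)) mod q"
        unfolding r_def x(1) using ti iC by (simp add: run_nth noise_def)
      moreover have "r y t i = (?X + e' (t, i)) mod q"
        unfolding rxy m unfolding r_def y(1) using ti iC by (simp add: run_nth noise_def)
      ultimately have "(?X + e (t, i)) mod q = (?X + e' (t, i)) mod q" using rxy by simp
      moreover have "e (t, i) < q" "e' (t, i) < q"
        using x(2) y(2) ti unfolding E_def by (auto simp: PiE_iff)
      ultimately show ?thesis using add_left_mod_cancel by blast
    qed
    then have "e = e'" using x(2) y(2) unfolding E_def by (intro PiE_ext) auto
    then show "x = y" using x y m by simp
  qed
  moreover have "r x s i < q" for x s i
    by (cases x) (simp add: r_def run_lt q)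
  then have "h ` G \<subseteq> F"
    unfolding h_def F_def by (auto split: if_splits)
  moreover have "finite F" unfolding F_def by (intro finite_PiE) auto
  ultimately have "card G \<le> card F" by (rule card_inj_on_le)
  also have "card F = q ^ (C * n)"
    unfolding F_def by (simp add: card_PiE card_cartesian_product mult.commute)
  finally show ?thesis unfolding G_def r_def by simp
qed


lemma powr_le_message_count: "real q powr x \<le> real (nat \<lceil>real q powr x\<rceil>)"
  by linarith

text \<open>Each noise pattern \<open>e\<close> is an admissible strategy, so the success
  probabilities sum to at least \<open>K / 2\<close> over the messages. Summing over all patterns
  and counting received arrays gives \<open>K \<le> 2 * q ^ (n * k)\<close>, too small for a rate
  above \<open>k\<close>.\<close>

lemma achievable_le_unjammed:
  assumes z: "zrw + zwo \<le> C" and ach: "achievable C zrw zro zwo R"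
  shows "R \<le> real C - real (zrw + zwo)"
proof (rule ccontr)
  assume R: "\<not> R \<le> real C - real (zrw + zwo)"
  define k where "k = C - (zrw + zwo)"
  define \<delta> where "\<delta> = R - real k"
  have \<delta>: "\<delta> > 0"
    using z R unfolding \<delta>_def k_def by simp
  obtain N where N: "\<And>n. n \<ge> N \<Longrightarrow> \<exists>q::nat. q \<ge> 2 \<and>
        (\<exists>ns enc dec W. ns \<noteq> [] \<and> sum_list ns = n \<and>
          (\<forall>Zrw Zro Zwo adv. admissible_sets C zrw zro zwo Zrw Zro Zwo \<longrightarrow>
             err_prob q C n ns (nat \<lceil>real q powr (real n * R)\<rceil>) enc dec W
               (Zrw \<union> Zro) (Zrw \<union> Zwo) adv < 1 / 2))"
    using ach[unfolded achievable_def, rule_format, of "1 / 2"] by auto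
  \<comment> \<open>Ensures \<open>n * \<delta> \<ge> 2\<close>: the gain
    \<open>q ^ 2 \<ge> 4\<close> then exceeds the factor 2 lost to error probability 1/2.\<close>
  define n where "n = max N (nat \<lceil>2 / \<delta>\<rceil>)"
  have "real n \<ge> 2 / \<delta>" unfolding n_def by linarith
  then have n\<delta>: "real n * \<delta> \<ge> 2" using \<delta> by (simp add: field_simps)
  define Zw where "Zw = {..<zrw} \<union> {zrw..<zrw + zwo}"
  have Zw: "Zw = {..<zrw + zwo}" unfolding Zw_def by auto
  have adm: "admissible_sets C zrw zro zwo {..<zrw} {} {zrw..<zrw + zwo}"
    using z unfolding admissible_sets_def by auto
  obtain q ns enc dec W where q: "q \<ge> 2"
    and err: "\<And>adv. err_prob q C n ns (nat \<lceil>real q powr (real n * R)\<rceil>) enc dec W {..<zrw} Zw adv < 1 / 2"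
    using N[of n] adm unfolding n_def Zw_def by fastforce
  define K where "K = nat \<lceil>real q powr (real n * R)\<rceil>"
  define E where "E = PiE ({..<n} \<times> Zw) (\<lambda>_. {..<q})"
  define good where "good = (\<lambda>(m, e :: nat \<times> nat \<Rightarrow> nat).
    {w. dec (run q C enc ns {..<zrw} Zw (\<lambda>t obs i. e (t, i)) m w n) = m})"
  have finE: "finite E" unfolding E_def Zw by (intro finite_PiE) auto
  have cardE: "card E = q ^ (n * (zrw + zwo))"
    unfolding E_def Zw by (simp add: card_PiE card_cartesian_product)
  have "(real q powr (real n * R)) > 0" using q by simp
  then have Kpos: "real K > 0" unfolding K_def by linarith
  have "(\<Sum>m<K. measure_pmf.prob W (good (m, e))) \<ge> real K / 2" for e
  proof -
    have "measure_pmf.prob W (good (m, e)) = 1 -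
        measure_pmf.prob W {w. dec (run q C enc ns {..<zrw} Zw (\<lambda>t obs i. e (t, i)) m w n) \<noteq> m}" for m
    proof -
      have "good (m, e) = UNIV - {w. dec (run q C enc ns {..<zrw} Zw (\<lambda>t obs i. e (t, i)) m w n) \<noteq> m}"
        unfolding good_def by auto
      then show ?thesis using measure_pmf.prob_compl[of _ W] by simp
    qed
    then have "(\<Sum>m<K. measure_pmf.prob W (good (m, e))) = real K - (\<Sum>m<K. measure_pmf.prob W
        {w. dec (run q C enc ns {..<zrw} Zw (\<lambda>t obs i. e (t, i)) m w n) \<noteq> m})"
      by (simp add: sum_subtractf)
    then show ?thesis
      using err[of "\<lambda>t obs i. e (t, i)"] Kpos
      unfolding err_prob_def K_def[symmetric] by (simp add: field_simps)
  qed
  then have "(\<Sum>e\<in>E. real K / 2) \<le> (\<Sum>e\<in>E. \<Sum>m<K. measure_pmf.prob W (good (m, e)))"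
    by (intro sum_mono)
  also have "\<dots> = (\<Sum>x\<in>{..<K} \<times> E. measure_pmf.prob W (good x))"
    by (subst sum.swap) (simp add: sum.cartesian_product)
  also have "\<dots> \<le> real (q ^ (C * n))"
  proof (rule sum_prob_le)
    show "finite ({..<K} \<times> E)" using finE by simp
    fix w
    have "{x \<in> {..<K} \<times> E. w \<in> good x} = {(m, e). m < K \<and> e \<in> E \<and>
        dec (run q C enc ns {..<zrw} Zw (\<lambda>t obs i. e (t, i)) m w n) = m}"
      unfolding good_def by auto
    then show "real (card {x \<in> {..<K} \<times> E. w \<in> good x}) \<le> real (q ^ (C * n))"
      using random_noise_success_le[of q Zw C K n dec enc ns "{..<zrw}" w] q z
      unfolding E_def Zw by simp
  qed
  finally have "real q ^ (n * (zrw + zwo)) * real K \<le> 2 * real q ^ (C * n)"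
    using cardE by simp
  moreover have "real q ^ (C * n) = real q ^ (n * (zrw + zwo)) * real q ^ (n * k)"
    using z unfolding k_def by (simp flip: power_add add_mult_distrib2 add: mult.commute)
  ultimately have le: "real K \<le> 2 * real q ^ (n * k)"
    using q by simp
  have "4 * real q ^ (n * k) \<le> real q ^ 2 * real q ^ (n * k)"
    using power_mono[of 2 "real q" 2] q by (intro mult_right_mono) auto
  also have "\<dots> = real q powr (real (n * k + 2))"
    using q by (subst powr_realpow) (auto simp: power_add power2_eq_square)
  also have "\<dots> \<le> real q powr (real n * R)"
    using q n\<delta> unfolding \<delta>_def by (intro powr_mono) (auto simp: algebra_simps)
  also have "\<dots> \<le> real K" unfolding K_def by (rule powr_le_message_count)
  finally have "4 * real q ^ (n * k) \<le> 2 * real q ^ (n * k)" using le by linarith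
  then show False using q by simp
qed

section \<open>Symmetrization\<close>

text \<open>The received array when the links in \<open>P\<close> follow the pair \<open>(m, w)\<close> and the others follow
  \<open>(m', w')\<close>. It arises from either pair as the true one, with Calvin simulating the other.\<close>

fun mixed_run where
  "mixed_run q C enc ns P m w m' w' 0 = (\<lambda>s i. 0)"
| "mixed_run q C enc ns P m w m' w' (Suc t) =
     (let Y = mixed_run q C enc ns P m w m' w' t
      in (\<lambda>s i. if s = t \<and> i < C then
            (if i \<in> P then xsym q enc ns m w Y t i else xsym q enc ns m' w' Y t i) else Y s i))"

lemma mixed_run_swap:
  "mixed_run q C enc ns P m w m' w' t = mixed_run q C enc ns (- P) m' w' m w t"
proof (induction t)
  case (Suc t)
  then show ?case by (intro ext) (simp add: Let_def)
qed simp

text \<open>Calvin recovers the feedback from what he reads: on \<open>P\<close> it is the transmitted symbol, elsewhere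
  his own substitute.\<close>

fun reconstruct where
  "reconstruct q C enc ns P m' w' obs 0 = (\<lambda>s i. 0)"
| "reconstruct q C enc ns P m' w' obs (Suc t) =
     (let Y = reconstruct q C enc ns P m' w' obs t
      in (\<lambda>s i. if s = t \<and> i < C then
            (if i \<in> P then obs t i else xsym q enc ns m' w' Y t i) else Y s i))"

text \<open>Modulo \<open>q\<close>, \<open>q - obs t i\<close> is the negative of the genuine
  symbol, so adding this term replaces the genuine symbol by the simulated one.\<close>

definition impersonate where
  "impersonate q C enc ns P m' w' t obs i = (if i \<in> P then 0 else
     xsym q enc ns m' w' (reconstruct q C enc ns P m' w' obs t) t i + (q - obs t i))"

text \<open>As Calvin reads every link, his reconstruction agrees with the true feedback; he can
  therefore compute the symbols of the simulated pair and substitute them outside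
  \<open>P\<close>.\<close>

lemma run_impersonate:
  assumes q: "q > 0" and Zw: "{..<C} - P \<subseteq> Zw"
  shows "run q C enc ns {..<C} Zw (impersonate q C enc ns P m' w') m w t
           = mixed_run q C enc ns P m w m' w' t"
proof (induction t)
  case 0
  show ?case by simp
next
  case (Suc t)
  let ?run = "run q C enc ns {..<C} Zw (impersonate q C enc ns P m' w') m w"
  let ?mix = "mixed_run q C enc ns P m w m' w'"
  define obs where "obs = (\<lambda>s j. if s \<le> t \<and> j \<in> {..<C} then xsym q enc ns m w (?run t) s j else 0)"
  \<comment> \<open>Both runs only append rows, so agreement at \<open>t\<close> gives agreement at
    all earlier times.\<close>
  have run_eq: "?run s = ?mix s" if "s \<le> t" for s
  proof -
    have "trunc s (?mix t) = ?mix s"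
      using that
    proof (induction t rule: dec_induct)
      case base
      have "?mix s u i = 0" if "u \<ge> s" for u i
        using that by (induction s) (auto simp: Let_def)
      then show ?case by (intro ext) (auto simp: trunc_def)
    next
      case (step t)
      have "trunc s (?mix (Suc t)) = trunc s (?mix t)"
        using step.hyps by (intro ext) (auto simp: trunc_def Let_def)
      then show ?case using step by simp
    qed
    then show ?thesis using trunc_run[OF that, of q C enc ns "{..<C}" Zw] Suc.IH by metis
  qed
  have rec: "reconstruct q C enc ns P m' w' obs s = ?mix s" if "s \<le> t" for s
    using that
  proof (induction s)
    case (Suc s)
    have "xsym q enc ns m w (?run t) s i = xsym q enc ns m w (?mix s) s i" for i
      using Suc.prems xsym_run[of s t q enc ns m w C "{..<C}" Zw "impersonate q C enc ns P m' w'" i]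
        xsym_run[of s s q enc ns m w C "{..<C}" Zw "impersonate q C enc ns P m' w'" i] run_eq[of s]
      by simp
    then show ?case using Suc by (intro ext) (auto simp: obs_def Let_def)
  qed simp
  have step: "?run (Suc t) = (\<lambda>s i. if s = t \<and> i < C then (xsym q enc ns m w (?run t) t i +
      (if i \<in> Zw then impersonate q C enc ns P m' w' t obs i else 0)) mod q else ?run t s i)"
    unfolding obs_def by (simp only: run.simps Let_def)
  have entry: "(xsym q enc ns m w (?run t) t i +
      (if i \<in> Zw then impersonate q C enc ns P m' w' t obs i else 0)) mod q =
      (if i \<in> P then xsym q enc ns m w (?mix t) t i else xsym q enc ns m' w' (?mix t) t i)" if i: "i < C" for i
  proof (cases "i \<in> P")
    case True
    then have "impersonate q C enc ns P m' w' t obs i = 0" by (simp add: impersonate_def)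
    then show ?thesis using True Suc.IH by (simp add: xsym_def)
  next
    case False
    define x where "x = xsym q enc ns m w (?mix t) t i"
    define x' where "x' = xsym q enc ns m' w' (?mix t) t i"
    have x: "x < q" "x' < q" using q unfolding x_def x'_def xsym_def by auto
    have "i \<in> Zw" using Zw i False by auto
    moreover have "impersonate q C enc ns P m' w' t obs i = x' + (q - x)"
      unfolding impersonate_def using False i rec[of t] Suc.IH by (simp add: obs_def x_def x'_def)
    moreover have "x + (x' + (q - x)) = x' + q" using x by simp
    ultimately show ?thesis using False Suc.IH x unfolding x_def[symmetric] x'_def[symmetric]
      by (simp add: x_def[symmetric])
  qed
  show ?case unfolding step using entry Suc.IH by (intro ext) (simp add: Let_def)
qed

text \<open>For \<open>m \<noteq> m'\<close> the mixed array arises from two genuine transmissions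
  and is decoded wrongly for at least one of them. Averaging over independent pairs
  \<open>(m, w)\<close> and \<open>(m', w')\<close> contradicts two small error
  probabilities.\<close>

lemma achievable_le_0_symmetrizable:
  assumes z: "zrw + zro = C" "C \<le> 2 * zrw" and ach: "achievable C zrw zro zwo R"
  shows "R \<le> 0"
proof (rule ccontr)
  assume "\<not> R \<le> 0"
  then have R: "R > 0" by simp
  obtain N where N: "\<And>n. n \<ge> N \<Longrightarrow> \<exists>q::nat. q \<ge> 2 \<and>
        (\<exists>ns enc dec W. ns \<noteq> [] \<and> sum_list ns = n \<and>
          (\<forall>Zrw Zro Zwo adv. admissible_sets C zrw zro zwo Zrw Zro Zwo \<longrightarrow>
             err_prob q C n ns (nat \<lceil>real q powr (real n * R)\<rceil>) enc dec W
               (Zrw \<union> Zro) (Zrw \<union> Zwo) adv < 1 / 8))"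
    using ach[unfolded achievable_def, rule_format, of "1 / 8"] by auto
  \<comment> \<open>A positive length makes \<open>q powr (n * R)\<close> exceed 1, hence
    \<open>K \<ge> 2\<close>.\<close>
  define n where "n = Suc N"
  \<comment> \<open>\<open>A\<close> and the set \<open>B\<close> below cover all links, since
    \<open>C \<le> 2 * zrw\<close>. Jamming within \<open>B\<close> imposes \<open>(m', w')\<close>
    outside \<open>A\<close>; jamming \<open>A\<close> imposes \<open>(m, w)\<close> on
    \<open>A\<close>.\<close>
  define A where "A = {..<zrw}"
  define B where "B = {C - zrw..<C}"
  have admA: "admissible_sets C zrw zro zwo A ({..<C} - A) {}"
    and admB: "admissible_sets C zrw zro zwo B ({..<C} - B) {}"
  proof -
    have "A \<subseteq> {..<C}" "B \<subseteq> {..<C}" "card A = zrw" "card B = zrw"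
      using z unfolding A_def B_def by auto
    then show "admissible_sets C zrw zro zwo A ({..<C} - A) {}"
      "admissible_sets C zrw zro zwo B ({..<C} - B) {}"
      using z(1) finite_subset[of _ "{..<C}"]
      unfolding admissible_sets_def by (auto simp: card_Diff_subset)
  qed
  obtain q ns enc dec W where q: "q \<ge> 2"
    and err: "\<And>Zrw Zro Zwo adv. admissible_sets C zrw zro zwo Zrw Zro Zwo \<Longrightarrow>
      err_prob q C n ns (nat \<lceil>real q powr (real n * R)\<rceil>) enc dec W (Zrw \<union> Zro) (Zrw \<union> Zwo) adv < 1 / 8"
    using N[of n] unfolding n_def by fastforce
  define K where "K = nat \<lceil>real q powr (real n * R)\<rceil>"
  have "real q powr (real n * R) > real q powr 0"
    using q R unfolding n_def by (intro powr_less_mono) auto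
  then have K: "K \<ge> 2" using q unfolding K_def by simp linarith
  define Y where "Y = (\<lambda>m m' (w, w'). mixed_run q C enc ns A m w m' w' n)"
  have AC: "A \<subseteq> {..<C}" "B \<subseteq> {..<C}" "{..<C} - A \<subseteq> B" using z unfolding A_def B_def by auto
  have errB: "(\<Sum>m<K. measure_pmf.prob W {w. dec (Y m m' (w, w')) \<noteq> m}) \<le> real K / 8" for m' w'
  proof -
    have "B \<union> ({..<C} - B) = {..<C}" using AC by auto
    then show ?thesis
      using err[OF admB, of "impersonate q C enc ns A m' w'"] K run_impersonate[of q C A B enc ns m' w'] AC q
      unfolding err_prob_def K_def[symmetric] Y_def by (simp add: field_simps)
  qed
  have errA: "(\<Sum>m'<K. measure_pmf.prob W {w'. dec (Y m m' (w, w')) \<noteq> m'}) \<le> real K / 8" for m w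
  proof -
    have "A \<union> ({..<C} - A) = {..<C}" using AC by auto
    then show ?thesis
      using err[OF admA, of "impersonate q C enc ns (- A) m w"] K
        run_impersonate[of q C "- A" A enc ns m w] AC q mixed_run_swap[of q C enc ns A m w]
      unfolding err_prob_def K_def[symmetric] Y_def by (simp add: field_simps)
  qed
  let ?P = "measure_pmf.prob (pair_pmf W W)"
  have intg: "integrable (measure_pmf W) (\<lambda>w. measure_pmf.prob W (S w))" for S :: "nat \<Rightarrow> nat set"
    by (intro measure_pmf.integrable_const_bound[where B = 1]) auto
  have pA: "(\<Sum>m'<K. ?P {x. dec (Y m m' x) \<noteq> m'}) \<le> real K / 8" for m
  proof -
    have "(\<Sum>m'<K. ?P {x. dec (Y m m' x) \<noteq> m'}) =
        measure_pmf.expectation W (\<lambda>w. \<Sum>m'<K. measure_pmf.prob W {w'. dec (Y m m' (w, w')) \<noteq> m'})"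
      by (subst Bochner_Integration.integral_sum) (auto simp: prob_pair_pmf intg)
    also have "\<dots> \<le> real K / 8"
      using errA by (intro measure_pmf.integral_le_const Bochner_Integration.integrable_sum intg) auto
    finally show ?thesis .
  qed
  have pB: "(\<Sum>m<K. ?P {x. dec (Y m m' x) \<noteq> m}) \<le> real K / 8" for m'
  proof -
    \<comment> \<open>\<open>prob_pair_pmf\<close> conditions on the first component, whereas here
      the second is held fixed; hence the swap.\<close>
    have "?P S = measure_pmf.expectation W (\<lambda>w'. measure_pmf.prob W {w. (w, w') \<in> S})" for S
    proof -
      have "?P S = measure_pmf.prob (map_pmf prod.swap (pair_pmf W W)) S"
        by (subst pair_commute_pmf) (simp add: case_prod_beta' prod.swap_def[abs_def])
      then show ?thesis by (simp add: prob_pair_pmf)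
    qed
    then have "(\<Sum>m<K. ?P {x. dec (Y m m' x) \<noteq> m}) =
        measure_pmf.expectation W (\<lambda>w'. \<Sum>m<K. measure_pmf.prob W {w. dec (Y m m' (w, w')) \<noteq> m})"
      by (subst Bochner_Integration.integral_sum) (auto simp: intg)
    also have "\<dots> \<le> real K / 8"
      using errB by (intro measure_pmf.integral_le_const Bochner_Integration.integrable_sum intg) auto
    finally show ?thesis .
  qed
  \<comment> \<open>One array cannot be decoded to two different messages.\<close>
  have "(if m = m' then 0 else 1) \<le> ?P {x. dec (Y m m' x) \<noteq> m'} + ?P {x. dec (Y m m' x) \<noteq> m}" for m m'
  proof (cases "m = m'")
    case False
    have "1 = ?P UNIV" by simp
    also have "UNIV = {x. dec (Y m m' x) \<noteq> m'} \<union> {x. dec (Y m m' x) \<noteq> m}" using False by auto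
    also have "?P \<dots> \<le> ?P {x. dec (Y m m' x) \<noteq> m'} + ?P {x. dec (Y m m' x) \<noteq> m}"
      by (intro measure_Un_le) auto
    finally show ?thesis using False by simp
  qed simp
  then have "(\<Sum>m<K. \<Sum>m'<K. if m = m' then 0 else 1) \<le>
      (\<Sum>m<K. \<Sum>m'<K. ?P {x. dec (Y m m' x) \<noteq> m'} + ?P {x. dec (Y m m' x) \<noteq> m})"
    by (intro sum_mono)
  also have "\<dots> = (\<Sum>m<K. \<Sum>m'<K. ?P {x. dec (Y m m' x) \<noteq> m'}) +
      (\<Sum>m'<K. \<Sum>m<K. ?P {x. dec (Y m m' x) \<noteq> m})"
    by (subst (3) sum.swap) (simp add: sum.distrib)
  also have "\<dots> \<le> (\<Sum>m<K. real K / 8) + (\<Sum>m'<K. real K / 8)"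
    by (intro add_mono sum_mono pA pB)
  also have "\<dots> = real K * real K / 4" by simp
  finally have "(\<Sum>m<K. \<Sum>m'<K. if m = m' then 0 else 1) \<le> real K * real K / 4" .
  moreover have "(\<Sum>m'<K. if m = m' then 0 else 1 :: real) = real K - 1" if "m < K" for m
  proof -
    have "(\<Sum>m'<K. if m = m' then 0 else 1 :: real) = (\<Sum>m'<K. 1 - (if m = m' then 1 else 0))"
      by (intro sum.cong) auto
    then show ?thesis using that by (simp add: sum_subtractf)
  qed
  ultimately have "real K * (real K - 1) \<le> real K * real K / 4" by simp
  then have "real K - 1 \<le> real K / 4"
    using K mult_le_cancel_left_pos[of "real K" "real K - 1" "real K / 4"] by simp
  then show False using K by simp
qed

section \<open>Reed-Solomon payload\<close>

text \<open>By induction, the lowest \<open>j\<close> base-\<open>q\<close> digits determine the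
  residue modulo \<open>q ^ j\<close>.\<close>

lemma digits_eqI:
  fixes m m' q :: nat
  assumes "m < q ^ M" "m' < q ^ M"
    and "\<And>j. j < M \<Longrightarrow> m div q ^ j mod q = m' div q ^ j mod q"
  shows "m = m'"
proof -
  have "m mod q ^ j = m' mod q ^ j" if "j \<le> M" for j
    using that
  proof (induction j)
    case (Suc j)
    have "x mod q ^ Suc j = q ^ j * (x div q ^ j mod q) + x mod q ^ j" for x
      using mod_mult2_eq[of x "q ^ j" q] by (simp add: mult.commute)
    then show ?case using Suc assms(3)[of j] by simp
  qed simp
  from this[of M] show ?thesis using assms by simp
qed

text \<open>Dividing by the linear factor of one root lowers the degree, and by primality the
  remaining points are roots of the quotient modulo \<open>p\<close>. This is the bound on the
  number of roots over the field of \<open>p\<close> elements, phrased with integer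
  polynomials.\<close>

lemma prime_dvd_coeffs_if_roots:
  fixes p :: int and P :: "int poly"
  assumes "prime p" "finite S"
    and "\<And>x y. x \<in> S \<Longrightarrow> y \<in> S \<Longrightarrow> p dvd x - y \<Longrightarrow> x = y"
    and "\<And>x. x \<in> S \<Longrightarrow> p dvd poly P x"
    and "\<And>j. j \<ge> card S \<Longrightarrow> coeff P j = 0"
  shows "p dvd coeff P j"
  using assms(2-)
proof (induction S arbitrary: P j rule: finite_induct)
  case empty
  then show ?case by simp
next
  case (insert x S)
  define Q where "Q = synthetic_div P x"
  have PQ: "P = [:-x, 1:] * Q + [:poly P x:]"
    unfolding Q_def by (rule synthetic_div_correct'[symmetric])
  have px: "p dvd poly P x" using insert.prems by simp
  have rootQ: "p dvd poly Q y" if y: "y \<in> S" for y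
  proof -
    have "poly P y = (y - x) * poly Q y + poly P x"
      by (subst PQ) (simp add: algebra_simps)
    moreover have "p dvd poly P y" using insert.prems y by simp
    ultimately have "p dvd (y - x) * poly Q y"
      using px by (simp add: dvd_add_left_iff)
    moreover have "\<not> p dvd y - x" using insert y by auto
    ultimately show ?thesis using \<open>prime p\<close> by (simp add: prime_dvd_mult_iff)
  qed
  have coeffQ: "coeff Q i = 0" if i: "i \<ge> card S" for i
  proof (cases "Q = 0")
    case False
    have "degree P \<le> card S"
      using insert by (intro degree_le) auto
    moreover have "degree P \<noteq> 0"
      using False synthetic_div_eq_0_iff[of P x] unfolding Q_def by simp
    ultimately have "degree Q < i"
      using i degree_synthetic_div[of P x] unfolding Q_def by simp
    then show ?thesis by (rule coeff_eq_0)
  qed simp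
  have "p dvd coeff Q i" for i
    using insert.IH[of Q i] insert.prems rootQ coeffQ by auto
  then show ?case
    using px by (subst PQ) (auto simp: coeff_pCons split: nat.split)
qed


text \<open>Reed-Solomon code: at time \<open>s\<close>, a block of \<open>k\<close>
  base-\<open>q\<close> digits of \<open>m\<close> gives the coefficients of a polynomial, evaluated
  at the link number.\<close>

definition mds_word :: "nat \<Rightarrow> nat \<Rightarrow> nat \<Rightarrow> nat \<Rightarrow> nat \<Rightarrow> nat" where
  "mds_word q k m s i = (\<Sum>j<k. (m div q ^ (s * k + j) mod q) * i ^ j) mod q"

text \<open>At each time the difference of the two polynomials has at least \<open>k\<close> roots
  modulo \<open>q\<close>, so all its coefficients vanish there. Link numbers are distinct residues
  because \<open>C \<le> q\<close>.\<close>

lemma mds_word_determines: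
  assumes "prime q" "C \<le> q" "m < q ^ (k * n)" "m' < q ^ (k * n)"
    and S: "S \<subseteq> {..<C}" "k \<le> card S"
    and agree: "\<And>s i. s < n \<Longrightarrow> i \<in> S \<Longrightarrow> mds_word q k m s i = mds_word q k m' s i"
  shows "m = m'"
proof (rule digits_eqI[OF assms(3,4)])
  fix l assume l: "l < k * n"
  then have k: "k > 0" by (cases k) auto
  \<comment> \<open>Digit \<open>l\<close> is coefficient \<open>l mod k\<close> of the polynomial
    sent at time \<open>l div k\<close>.\<close>
  define s where "s = l div k"
  define d where "d = (\<lambda>m j. m div q ^ (s * k + j) mod q)"
  define P where "P = (\<Sum>j<k. monom (int (d m j) - int (d m' j)) j)"
  have s: "s < n" using l k unfolding s_def by (simp add: less_mult_imp_div_less mult.commute)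
  have fin: "finite S" using S(1) finite_subset by blast
  have coeffP: "coeff P j = (if j < k then int (d m j) - int (d m' j) else 0)" for j
    unfolding P_def by (simp add: coeff_sum)
  have "int q dvd coeff P (l mod k)"
  proof (rule prime_dvd_coeffs_if_roots[where S = "int ` S"])
    show "prime (int q)" using assms(1) by simp
    show "finite (int ` S)" using fin by simp
    show "x = y" if "x \<in> int ` S" "y \<in> int ` S" "int q dvd x - y" for x y
    proof -
      from that obtain a b where ab: "x = int a" "y = int b" "a < q" "b < q"
        using S(1) assms(2) by fastforce
      with that(3) have "int a mod int q = int b mod int q" by (simp only: mod_eq_dvd_iff)
      with ab show ?thesis by (simp only: zmod_int[symmetric] of_nat_eq_iff mod_less)
    qed
    show "coeff P j = 0" if "j \<ge> card (int ` S)" for j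
      using that S(2) by (simp add: coeffP card_image)
    show "int q dvd poly P x" if "x \<in> int ` S" for x
    proof -
      from that obtain i where i: "i \<in> S" "x = int i" by auto
      have "(\<Sum>j<k. d m j * i ^ j) mod q = (\<Sum>j<k. d m' j * i ^ j) mod q"
        using agree[OF s i(1)] unfolding mds_word_def d_def .
      then have "int (\<Sum>j<k. d m j * i ^ j) mod int q = int (\<Sum>j<k. d m' j * i ^ j) mod int q"
        by (simp only: zmod_int[symmetric])
      then have "int q dvd int (\<Sum>j<k. d m j * i ^ j) - int (\<Sum>j<k. d m' j * i ^ j)"
        by (simp only: mod_eq_dvd_iff)
      also have "int (\<Sum>j<k. d m j * i ^ j) - int (\<Sum>j<k. d m' j * i ^ j) = poly P x"
        unfolding P_def i(2) by (simp add: poly_sum poly_monom left_diff_distrib sum_subtractf)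
      finally show ?thesis .
    qed
  qed
  then have "int q dvd int (d m (l mod k)) - int (d m' (l mod k))"
    using k by (simp add: coeffP)
  then have "int (d m (l mod k)) mod int q = int (d m' (l mod k)) mod int q"
    by (simp only: mod_eq_dvd_iff)
  then have "d m (l mod k) mod q = d m' (l mod k) mod q"
    by (simp only: zmod_int[symmetric] of_nat_eq_iff)
  then have "d m (l mod k) = d m' (l mod k)" unfolding d_def by simp
  then show "m div q ^ l mod q = m' div q ^ l mod q"
    unfolding d_def s_def by simp
qed

section \<open>Reporting the jammed links\<close>

text \<open>For the true message this is the set of links with altered payload. Alice computes it
  from the feedback, Bob for every candidate message.\<close>

definition mismatch :: "nat \<Rightarrow> nat \<Rightarrow> (nat \<Rightarrow> nat \<Rightarrow> nat \<Rightarrow> nat) \<Rightarrow> nat \<Rightarrow> (nat \<Rightarrow> nat \<Rightarrow> nat) \<Rightarrow> nat set" where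
  "mismatch C n\<^sub>1 f m V = {i. i < C \<and> (\<exists>s<n\<^sub>1. V s i \<noteq> f m s i)}"

text \<open>Being a number below \<open>2 ^ C\<close>, the set can be sent as one symbol or serve as
  the index of a key.\<close>

definition report :: "nat \<Rightarrow> nat \<Rightarrow> (nat \<Rightarrow> nat \<Rightarrow> nat \<Rightarrow> nat) \<Rightarrow> nat \<Rightarrow> (nat \<Rightarrow> nat \<Rightarrow> nat) \<Rightarrow> nat" where
  "report C n\<^sub>1 f m V = set_encode (mismatch C n\<^sub>1 f m V)"

text \<open>Payload, then \<open>L\<close> rows of key symbols, then one symbol common to all links.
  The randomness is a natural number and so holds the list of key symbols in encoded form;
  \<open>g\<close> is the rule for announcing the report.\<close>

definition report_enc where
  "report_enc C n\<^sub>1 L f g m w V s i = (if s < n\<^sub>1 then f m s i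
     else if s < n\<^sub>1 + L then (from_nat w :: nat list) ! ((s - n\<^sub>1) * C + i)
     else g V (report C n\<^sub>1 f m V))"

lemma finite_mismatch: "finite (mismatch C n\<^sub>1 f m V)"
  unfolding mismatch_def by simp

lemma report_less: "report C n\<^sub>1 f m V < 2 ^ C"
proof -
  have "report C n\<^sub>1 f m V \<le> (\<Sum>i<C. 2 ^ i)"
    unfolding report_def set_encode_def by (intro sum_mono2) (auto simp: mismatch_def)
  also have "\<dots> = 2 ^ C - 1" using sum_power2[of C] by (simp add: lessThan_atLeast0)
  also have "\<dots> < 2 ^ C" by simp
  finally show ?thesis .
qed

text \<open>Outside the common mismatch set both codewords equal the received payload, and at least
  \<open>k\<close> links remain there.\<close>

lemma report_determines:
  assumes "prime q" "C \<le> q" "m < q ^ (k * n\<^sub>1)" "m' < q ^ (k * n\<^sub>1)"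
    and card: "card (mismatch C n\<^sub>1 (mds_word q k) m V) \<le> C - k" and "k \<le> C"
    and rep: "report C n\<^sub>1 (mds_word q k) m V = report C n\<^sub>1 (mds_word q k) m' V"
  shows "m = m'"
proof (rule mds_word_determines[OF assms(1-4)])
  let ?M = "mismatch C n\<^sub>1 (mds_word q k) m V"
  have M: "?M = mismatch C n\<^sub>1 (mds_word q k) m' V"
    using rep unfolding report_def by (metis finite_mismatch set_encode_inverse)
  show "{..<C} - ?M \<subseteq> {..<C}" by blast
  have "card ({..<C} - ?M) = C - card ?M"
    by (subst card_Diff_subset) (auto simp: mismatch_def)
  then show "k \<le> card ({..<C} - ?M)" using card \<open>k \<le> C\<close> by simp
  show "mds_word q k m s i = mds_word q k m' s i" if "s < n\<^sub>1" "i \<in> {..<C} - ?M" for s i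
  proof -
    have "V s i = mds_word q k m s i" using that unfolding mismatch_def by auto
    moreover have "V s i = mds_word q k m' s i" using that M unfolding mismatch_def by auto
    ultimately show ?thesis by simp
  qed
qed

text \<open>The second round consists of time \<open>N\<close> alone: its symbol may use all earlier
  feedback, the earlier symbols use none.\<close>

lemma rstart_two_rounds: "s \<le> N \<Longrightarrow> rstart [N, Suc 0] s = (if s < N then 0 else N)"
proof -
  assume s: "s \<le> N"
  have S: "{sum_list (take k [N, Suc 0]) | k. k \<le> length [N, Suc 0] \<and> sum_list (take k [N, Suc 0]) \<le> s}
    = {x \<in> {0, N, N + 1}. x \<le> s}" (is "?L = ?R")
  proof
    show "?L \<subseteq> ?R"
    proof
      fix x assume "x \<in> ?L"
      then obtain k where k: "k \<le> 2" "x = sum_list (take k [N, Suc 0])" "x \<le> s"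
        by (auto simp del: take.simps take_Suc_Cons simp: numeral_2_eq_2)
      then have "k = 0 \<or> k = 1 \<or> k = 2" by arith
      then show "x \<in> ?R" using k by (auto simp: numeral_2_eq_2)
    qed
    have "0 = sum_list (take 0 [N, Suc 0])" "N = sum_list (take 1 [N, Suc 0])" "N + 1 = sum_list (take 2 [N, Suc 0])"
      by simp_all
    then show "?R \<subseteq> ?L" by fastforce
  qed
  show ?thesis
  proof (cases "s < N")
    case True
    then have "{x \<in> {0, N, N + 1}. x \<le> s} = {0}" by auto
    then show ?thesis using True unfolding rstart_def S by simp
  next
    case False
    then have "{x \<in> {0, N, N + 1}. x \<le> s} = {0, N}" using s by auto
    then show ?thesis using False unfolding rstart_def S by simp
  qed
qed

section \<open>The two-round scheme for a fixed message and adversary\<close>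

text \<open>\<open>g\<close> stays abstract because it becomes the identity for majority decoding
  and the key sum for decoding with keys.\<close>

locale report_scheme =
  fixes q C n\<^sub>1 L :: nat and f :: "nat \<Rightarrow> nat \<Rightarrow> nat \<Rightarrow> nat" and g :: "(nat \<Rightarrow> nat \<Rightarrow> nat) \<Rightarrow> nat \<Rightarrow> nat"
    and Zr Zw :: "nat set" and adv :: "nat \<Rightarrow> (nat \<Rightarrow> nat \<Rightarrow> nat) \<Rightarrow> nat \<Rightarrow> nat" and m :: nat
  assumes q: "q > 0" and f_less: "\<And>m s i. f m s i < q" and g_less: "\<And>V d. d < 2 ^ C \<Longrightarrow> g V d < q"
    and Zr: "Zr \<subseteq> {..<C}"
begin

abbreviation "N \<equiv> n\<^sub>1 + L"
abbreviation "enc \<equiv> report_enc C n\<^sub>1 L f g"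
abbreviation "rcv \<equiv> run q C enc [N, Suc 0] Zr Zw adv m"
abbreviation "rep w \<equiv> report C n\<^sub>1 f m (rcv w N)"
abbreviation "jam \<equiv> noise q C enc [N, Suc 0] Zr Zw adv m"

lemma xsym_first_round:
  assumes "s < N" "s \<le> t"
  shows "xsym q enc [N, Suc 0] m w (rcv w t) s i = enc m w (\<lambda>_ _. 0) s i mod q"
  using assms by (simp add: xsym_run rstart_two_rounds)

lemma xsym_last_round:
  assumes "N \<le> t"
  shows "xsym q enc [N, Suc 0] m w (rcv w t) N i = g (rcv w N) (rep w)"
  using assms g_less[OF report_less] by (simp add: xsym_run rstart_two_rounds report_enc_def)

lemma rcv_first_round:
  assumes "s < N" "s < t" "i < C"
  shows "rcv w t s i = (enc m w (\<lambda>_ _. 0) s i + jam w s i) mod q"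
  using assms run_nth[of s t i C q enc "[N, Suc 0]" Zr Zw adv m w] xsym_first_round[of s t w i]
  by (simp add: mod_add_left_eq)

lemma rcv_last_round:
  assumes "i < C"
  shows "rcv w (Suc N) N i = (g (rcv w N) (rep w) + jam w N i) mod q"
  using assms run_nth[of N "Suc N" i C q enc "[N, Suc 0]" Zr Zw adv m w] xsym_last_round[of "Suc N" w i]
  by (simp only: lessI le_simps)

lemma rcv_last_unjammed:
  assumes "i < C" "i \<notin> Zw"
  shows "rcv w (Suc N) N i = g (rcv w N) (rep w)"
  using assms rcv_last_round[of i w] g_less[OF report_less] by (simp add: noise_def)

lemma mismatch_subset_jammed: "mismatch C n\<^sub>1 f m (rcv w N) \<subseteq> Zw"
proof
  fix i assume "i \<in> mismatch C n\<^sub>1 f m (rcv w N)"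
  then obtain s where s: "i < C" "s < n\<^sub>1" "rcv w N s i \<noteq> f m s i"
    unfolding mismatch_def by auto
  show "i \<in> Zw"
  proof (rule ccontr)
    assume "i \<notin> Zw"
    then have "rcv w N s i = f m s i"
      using rcv_first_round[of s N i w] s f_less by (simp add: noise_def report_enc_def)
    with s show False by simp
  qed
qed

text \<open>Changing a key symbol on a link that is not read changes nothing that Calvin sees before
  the last round, and nothing at all that he sees if the reported key is a different one.\<close>

lemma key_symbol_determined:
  fixes xs ys :: "nat list"
  assumes g: "\<And>V d. g V d = (\<Sum>i<C. V (n\<^sub>1 + d) i) mod q"
    and b: "b < C" "b \<notin> Zr" and d: "d < L"
    and xs: "xs ! (d * C + b) < q" and ys: "ys ! (d * C + b) < q"
    and eq: "\<And>l. l \<noteq> d * C + b \<Longrightarrow> xs ! l = ys ! l"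
    and ne: "rep (to_nat xs) \<noteq> d"
    and i: "i < C"
    and forged: "rcv (to_nat xs) (Suc N) N i = g (rcv (to_nat xs) N) d"
      "rcv (to_nat ys) (Suc N) N i = g (rcv (to_nat ys) N) d"
  shows "xs ! (d * C + b) = ys ! (d * C + b)"
proof -
  define x where "x = to_nat xs"
  define y where "y = to_nat ys"
  \<comment> \<open>List position \<open>d * C + b\<close> is sent only at time
    \<open>n\<^sub>1 + d\<close> on link \<open>b\<close>, by uniqueness of quotient and
    remainder.\<close>
  have enc_eq: "enc m x (\<lambda>_ _. 0) s j = enc m y (\<lambda>_ _. 0) s j"
    if "s < N" "j < C" "(s, j) \<noteq> (n\<^sub>1 + d, b)" for s j
  proof -
    have "(s - n\<^sub>1) * C + j \<noteq> d * C + b" if s: "s \<ge> n\<^sub>1"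
    proof
      assume *: "(s - n\<^sub>1) * C + j = d * C + b"
      then have "((s - n\<^sub>1) * C + j) div C = (d * C + b) div C"
        "((s - n\<^sub>1) * C + j) mod C = (d * C + b) mod C" by simp_all
      then have "s - n\<^sub>1 = d" "j = b" using \<open>j < C\<close> b by simp_all
      with s \<open>(s, j) \<noteq> (n\<^sub>1 + d, b)\<close> show False by auto
    qed
    then show ?thesis using eq that by (simp add: report_enc_def x_def y_def)
  qed
  \<comment> \<open>First-round symbols ignore feedback and link \<open>b\<close> is not read, so
    both lists give Calvin the same view.\<close>
  have noise_eq: "jam x s j = jam y s j" if "s < N" for s j
  proof -
    have "(\<lambda>u l. if u \<le> s \<and> l \<in> Zr then xsym q enc [N, Suc 0] m x (rcv x s) u l else 0)
        = (\<lambda>u l. if u \<le> s \<and> l \<in> Zr then xsym q enc [N, Suc 0] m y (rcv y s) u l else 0)"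
    proof (intro ext if_cong refl)
      fix u l assume "u \<le> s \<and> l \<in> Zr"
      then have "u \<le> s" "u < N" "l < C" "l \<noteq> b" using that Zr b by auto
      then show "xsym q enc [N, Suc 0] m x (rcv x s) u l = xsym q enc [N, Suc 0] m y (rcv y s) u l"
        using enc_eq[of u l] by (simp add: xsym_first_round)
    qed
    then show ?thesis unfolding noise_def by simp
  qed
  have V_eq: "rcv x N s j = rcv y N s j" if "(s, j) \<noteq> (n\<^sub>1 + d, b)" for s j
  proof (cases "s < N \<and> j < C")
    case True
    then show ?thesis using that by (simp add: rcv_first_round noise_eq enc_eq)
  next
    case False
    then have "N \<le> s \<or> C \<le> j" by auto
    then show ?thesis by (simp add: run_beyond)
  qed
  have rep_eq: "rep x = rep y"
  proof -
    have "rcv x N s j = rcv y N s j" if "s < n\<^sub>1" for s j using V_eq[of s j] that by simp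
    then have "mismatch C n\<^sub>1 f m (rcv x N) = mismatch C n\<^sub>1 f m (rcv y N)"
      unfolding mismatch_def by auto
    then show ?thesis unfolding report_def by simp
  qed
  \<comment> \<open>The announced key comes from a row other than \<open>n\<^sub>1 + d\<close>,
    since the report differs from \<open>d\<close>.\<close>
  have key_eq: "g (rcv x N) (rep x) = g (rcv y N) (rep y)"
  proof -
    have "rcv x N (n\<^sub>1 + rep y) j = rcv y N (n\<^sub>1 + rep y) j" for j
      using V_eq[of "n\<^sub>1 + rep y" j] ne rep_eq unfolding x_def y_def by simp
    then show ?thesis unfolding rep_eq g by simp
  qed
  have "jam x N i = jam y N i"
  proof -
    have "(\<lambda>u l. if u \<le> N \<and> l \<in> Zr then xsym q enc [N, Suc 0] m x (rcv x N) u l else 0)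
        = (\<lambda>u l. if u \<le> N \<and> l \<in> Zr then xsym q enc [N, Suc 0] m y (rcv y N) u l else 0)"
    proof (intro ext if_cong refl)
      fix u l assume ul: "u \<le> N \<and> l \<in> Zr"
      show "xsym q enc [N, Suc 0] m x (rcv x N) u l = xsym q enc [N, Suc 0] m y (rcv y N) u l"
      proof (cases "u < N")
        case True
        moreover have "l < C" "l \<noteq> b" using ul Zr b by auto
        ultimately show ?thesis using enc_eq[of u l] by (simp add: xsym_first_round)
      next
        case False
        then have "u = N" using ul by simp
        then show ?thesis using key_eq by (simp only: xsym_last_round[OF order_refl])
      qed
    qed
    then show ?thesis unfolding noise_def by simp
  qed
  then have "rcv x (Suc N) N i = rcv y (Suc N) N i"
    using i key_eq by (simp only: rcv_last_round)
  then have "g (rcv x N) d = g (rcv y N) d"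
    using forged unfolding x_def y_def by simp
  \<comment> \<open>Isolates the changed symbol inside the key; the other summands agree for both
    lists.\<close>
  moreover have "g (rcv z N) d = ((jam z (n\<^sub>1 + d) b + (\<Sum>j\<in>{..<C} - {b}. rcv z N (n\<^sub>1 + d) j))
      + enc m z (\<lambda>_ _. 0) (n\<^sub>1 + d) b) mod q" for z
  proof -
    have "(\<Sum>j<C. rcv z N (n\<^sub>1 + d) j) = (enc m z (\<lambda>_ _. 0) (n\<^sub>1 + d) b + jam z (n\<^sub>1 + d) b) mod q
       + (\<Sum>j\<in>{..<C} - {b}. rcv z N (n\<^sub>1 + d) j)"
      using b d by (subst sum.remove[of _ b]) (auto simp: rcv_first_round)
    then show ?thesis unfolding g by (simp only: mod_add_left_eq) (simp only: ac_simps)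
  qed
  moreover have "jam x (n\<^sub>1 + d) b = jam y (n\<^sub>1 + d) b" using noise_eq d by simp
  moreover have "(\<Sum>j\<in>{..<C} - {b}. rcv x N (n\<^sub>1 + d) j) = (\<Sum>j\<in>{..<C} - {b}. rcv y N (n\<^sub>1 + d) j)"
    using V_eq by (intro sum.cong) auto
  ultimately have "((jam x (n\<^sub>1 + d) b + (\<Sum>j\<in>{..<C} - {b}. rcv x N (n\<^sub>1 + d) j))
      + enc m x (\<lambda>_ _. 0) (n\<^sub>1 + d) b) mod q = ((jam x (n\<^sub>1 + d) b + (\<Sum>j\<in>{..<C} - {b}. rcv x N (n\<^sub>1 + d) j))
      + enc m y (\<lambda>_ _. 0) (n\<^sub>1 + d) b) mod q"
    by metis
  then have "enc m x (\<lambda>_ _. 0) (n\<^sub>1 + d) b = enc m y (\<lambda>_ _. 0) (n\<^sub>1 + d) b"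
    by (rule add_left_mod_cancel[rotated 2]) (use xs ys d in \<open>simp_all add: report_enc_def x_def y_def\<close>)
  then show ?thesis using d by (simp add: report_enc_def x_def y_def)
qed

end

section \<open>The two decoders\<close>

lemma mds_word_less: "q > 0 \<Longrightarrow> mds_word q k m s i < q"
  by (simp add: mds_word_def)

text \<open>A candidate must explain the payload and the last row with at most \<open>z\<close>
  deviating links each. \<open>SOME\<close> stands for an exhaustive search.\<close>

definition majority_dec where
  "majority_dec C n\<^sub>1 N f K z Y = (SOME m. m < K \<and> card (mismatch C n\<^sub>1 f m (trunc N Y)) \<le> z \<and>
     card {i. i < C \<and> Y N i \<noteq> report C n\<^sub>1 f m (trunc N Y)} \<le> z)"

text \<open>Bob has the received symbols and Alice learns them by feedback; additive jamming only
  shifts the contribution of an unread link.\<close>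

definition link_sum_key :: "nat \<Rightarrow> nat \<Rightarrow> nat \<Rightarrow> (nat \<Rightarrow> nat \<Rightarrow> nat) \<Rightarrow> nat \<Rightarrow> nat" where
  "link_sum_key q C n\<^sub>1 V d = (\<Sum>i<C. V (n\<^sub>1 + d) i) mod q"

text \<open>A matching key on one link is accepted as evidence: an unjammed link carries the
  announced key, and any other key has to be guessed.\<close>

definition key_dec where
  "key_dec q C n\<^sub>1 N f K z Y = (SOME m. m < K \<and> card (mismatch C n\<^sub>1 f m (trunc N Y)) \<le> z \<and>
     (\<exists>i<C. Y N i = link_sum_key q C n\<^sub>1 (trunc N Y) (report C n\<^sub>1 f m (trunc N Y))))"

text \<open>If two accepted candidates had different reports, every link would contradict one of
  them, although at most \<open>2 * (C - k) < C\<close> links do.\<close>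

lemma majority_dec_correct:
  assumes "prime q" "2 ^ C \<le> q" "m < K" "K \<le> q ^ (k * n\<^sub>1)" "k \<le> C" "C < 2 * k"
    and Zr: "Zr \<subseteq> {..<C}" and Zw: "Zw \<subseteq> {..<C}" "card Zw \<le> C - k"
  shows "majority_dec C n\<^sub>1 (n\<^sub>1 + L) (mds_word q k) K (C - k)
    (run q C (report_enc C n\<^sub>1 L (mds_word q k) (\<lambda>V d. d)) [n\<^sub>1 + L, Suc 0] Zr Zw adv m w (Suc (n\<^sub>1 + L))) = m"
proof -
  have q: "q > 0" using assms(1) by (simp add: prime_gt_0_nat)
  interpret report_scheme q C n\<^sub>1 L "mds_word q k" "\<lambda>V d. d" Zr Zw adv m
    by unfold_locales (use q assms(2) Zr in \<open>auto simp: mds_word_less\<close>)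
  define V where "V = rcv w N"
  define Y where "Y = rcv w (Suc N)"
  have V: "trunc N Y = V" unfolding V_def Y_def by (rule trunc_run) simp
  have finZw: "finite Zw" using Zw finite_subset by blast
  have C: "C \<le> q" using assms(2) less_exp[of C] by linarith
  let ?mis = "\<lambda>m. mismatch C n\<^sub>1 (mds_word q k) m V"
  let ?rep = "\<lambda>m. report C n\<^sub>1 (mds_word q k) m V"
  have ok: "card (?mis m) \<le> C - k" "card {i. i < C \<and> Y N i \<noteq> ?rep m} \<le> C - k"
  proof -
    have "card (?mis m) \<le> card Zw"
      using mismatch_subset_jammed[of w] finZw unfolding V_def by (intro card_mono) auto
    then show "card (?mis m) \<le> C - k" using Zw by simp
    have "{i. i < C \<and> Y N i \<noteq> ?rep m} \<subseteq> Zw"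
      using rcv_last_unjammed[of _ w] unfolding V_def Y_def by auto
    then have "card {i. i < C \<and> Y N i \<noteq> ?rep m} \<le> card Zw" using finZw by (intro card_mono) auto
    then show "card {i. i < C \<and> Y N i \<noteq> ?rep m} \<le> C - k" using Zw by simp
  qed
  have "m' = m" if m': "m' < K" "card {i. i < C \<and> Y N i \<noteq> ?rep m'} \<le> C - k" for m'
  proof -
    have "?rep m = ?rep m'"
    proof (rule ccontr)
      assume ne: "?rep m \<noteq> ?rep m'"
      have "{..<C} \<subseteq> {i. i < C \<and> Y N i \<noteq> ?rep m} \<union> {i. i < C \<and> Y N i \<noteq> ?rep m'}" using ne by auto
      then have "card {..<C} \<le> card ({i. i < C \<and> Y N i \<noteq> ?rep m} \<union> {i. i < C \<and> Y N i \<noteq> ?rep m'})"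
        by (intro card_mono) auto
      also have "\<dots> \<le> (C - k) + (C - k)"
        using card_Un_le add_mono[OF ok(2) m'(2)] by (rule order_trans)
      finally show False using assms(5,6) by simp
    qed
    then show ?thesis
      using report_determines[OF assms(1) C, of m k n\<^sub>1 m' V] ok(1) m' assms(3-5) by simp
  qed
  then have "majority_dec C n\<^sub>1 N (mds_word q k) K (C - k) Y = m"
    unfolding majority_dec_def V using ok \<open>m < K\<close> by (intro some_equality) blast+
  then show ?thesis unfolding Y_def .
qed

text \<open>An unjammed link delivers the true key. Without forgery every accepted candidate has the
  true report, which together with the payload fixes the message.\<close>

lemma key_dec_correct:
  fixes n\<^sub>1 L w :: nat and adv :: "nat \<Rightarrow> (nat \<Rightarrow> nat \<Rightarrow> nat) \<Rightarrow> nat \<Rightarrow> nat"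
  assumes "prime q" "C \<le> q" "m < K" "K \<le> q ^ (k * n\<^sub>1)" "k \<le> C" "0 < k"
    and Zr: "Zr \<subseteq> {..<C}" and Zw: "Zw \<subseteq> {..<C}" "card Zw \<le> C - k"
  defines "N \<equiv> n\<^sub>1 + L"
  defines "Y \<equiv> run q C (report_enc C n\<^sub>1 L (mds_word q k) (link_sum_key q C n\<^sub>1)) [N, Suc 0] Zr Zw adv m w (Suc N)"
  defines "V \<equiv> run q C (report_enc C n\<^sub>1 L (mds_word q k) (link_sum_key q C n\<^sub>1)) [N, Suc 0] Zr Zw adv m w N"
  assumes unforged: "\<And>d i. d < 2 ^ C \<Longrightarrow> i < C \<Longrightarrow> report C n\<^sub>1 (mds_word q k) m V \<noteq> d \<Longrightarrow>
    Y N i \<noteq> link_sum_key q C n\<^sub>1 V d"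
  shows "key_dec q C n\<^sub>1 N (mds_word q k) K (C - k) Y = m"
proof -
  have q: "q > 0" using assms(1) by (simp add: prime_gt_0_nat)
  interpret report_scheme q C n\<^sub>1 L "mds_word q k" "link_sum_key q C n\<^sub>1" Zr Zw adv m
    by unfold_locales (use q Zr in \<open>auto simp: mds_word_less link_sum_key_def\<close>)
  have V: "trunc N Y = V" unfolding V_def Y_def by (rule trunc_run) simp
  have finZw: "finite Zw" using Zw finite_subset by blast
  let ?mis = "\<lambda>m. mismatch C n\<^sub>1 (mds_word q k) m V"
  let ?rep = "\<lambda>m. report C n\<^sub>1 (mds_word q k) m V"
  have ok: "card (?mis m) \<le> C - k"
  proof -
    have "card (?mis m) \<le> card Zw"
      using mismatch_subset_jammed[of w] finZw unfolding V_def N_def by (intro card_mono) auto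
    then show "card (?mis m) \<le> C - k" using Zw by simp
  qed
  have "\<exists>i<C. i \<notin> Zw"
  proof (rule ccontr)
    assume "\<not> ?thesis"
    then have "{..<C} \<subseteq> Zw" by auto
    then have "card {..<C} \<le> card Zw" using finZw by (intro card_mono)
    then show False using Zw assms(5,6) by simp
  qed
  then have ok': "\<exists>i<C. Y N i = link_sum_key q C n\<^sub>1 V (?rep m)"
    using rcv_last_unjammed[of _ w] unfolding V_def Y_def N_def by blast
  have "m' = m" if m': "m' < K" "\<exists>i<C. Y N i = link_sum_key q C n\<^sub>1 V (?rep m')" for m'
  proof -
    have "?rep m = ?rep m'" using unforged[OF report_less] m' by blast
    then show ?thesis
      using report_determines[OF assms(1,2), of m k n\<^sub>1 m' V] ok m' assms(3-5) by simp
  qed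
  then show ?thesis
    unfolding key_dec_def V using ok ok' \<open>m < K\<close> by (intro some_equality) blast+
qed

section \<open>Probability of a forged key\<close>

text \<open>Overwriting entry \<open>j\<close> by an arbitrary value below \<open>q\<close> is
  injective on \<open>S \<times> {..<q}\<close>, since the rest of the list determines the lost
  entry.\<close>

lemma card_determined_position_le:
  fixes S :: "nat list set"
  assumes "j < M"
    and S: "\<And>xs. xs \<in> S \<Longrightarrow> length xs = M \<and> set xs \<subseteq> {..<q}"
    and det: "\<And>xs ys. xs \<in> S \<Longrightarrow> ys \<in> S \<Longrightarrow> (\<And>l. l \<noteq> j \<Longrightarrow> xs ! l = ys ! l) \<Longrightarrow> xs ! j = ys ! j"
  shows "card S * q \<le> q ^ M"
proof -
  let ?h = "\<lambda>(xs :: nat list, v :: nat). xs[j := v]"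
  let ?A = "{xs. set xs \<subseteq> {..<q} \<and> length xs = M}"
  have "inj_on ?h (S \<times> {..<q})"
  proof (rule inj_onI, clarify)
    fix xs v ys v' assume *: "xs \<in> S" "ys \<in> S" "xs[j := v] = ys[j := v']"
    have len: "length xs = M" "length ys = M" using S * by auto
    have v: "v = v'" using arg_cong[OF *(3), of "\<lambda>zs. zs ! j"] len \<open>j < M\<close> by simp
    have eq: "xs ! l = ys ! l" if "l \<noteq> j" for l
      using arg_cong[OF *(3), of "\<lambda>zs. zs ! l"] that by simp
    then have "xs ! j = ys ! j" by (rule det[OF *(1,2)])
    with eq have "xs ! l = ys ! l" for l by (cases "l = j") auto
    then have "xs = ys" using len by (intro nth_equalityI) auto
    with v show "xs = ys \<and> v = v'" by simp
  qed
  moreover have "?h ` (S \<times> {..<q}) \<subseteq> ?A"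
    using S set_update_subset_insert by fastforce
  moreover have "finite ?A" by (intro finite_lists_length_eq) simp
  ultimately have "card (S \<times> {..<q}) \<le> card ?A" by (rule card_inj_on_le)
  then show ?thesis by (simp add: card_lists_length_eq card_cartesian_product)
qed

definition key_pmf :: "nat \<Rightarrow> nat \<Rightarrow> nat pmf" where
  "key_pmf q M = map_pmf to_nat (pmf_of_set {xs :: nat list. set xs \<subseteq> {..<q} \<and> length xs = M})"

text \<open>Union bound over the \<open>L\<close> possible reports and the \<open>C\<close> links:
  the key of a given report that is not the announced one appears on a given link with probability
  at most \<open>1 / q\<close>.\<close>

lemma key_dec_error_le:
  fixes n\<^sub>1 C :: nat
  assumes "prime q" "C \<le> q" "m < K" "K \<le> q ^ (k * n\<^sub>1)" "k \<le> C" "0 < k"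
    and readable: "Zr \<subseteq> {..<C}" "card Zr < C" and Zw: "Zw \<subseteq> {..<C}" "card Zw \<le> C - k"
  defines "L \<equiv> 2 ^ C"
  defines "N \<equiv> n\<^sub>1 + L"
  shows "measure_pmf.prob (key_pmf q (C * L)) {w. key_dec q C n\<^sub>1 N (mds_word q k) K (C - k)
    (run q C (report_enc C n\<^sub>1 L (mds_word q k) (link_sum_key q C n\<^sub>1)) [N, Suc 0] Zr Zw adv m w (Suc N)) \<noteq> m}
      \<le> real (C * L) / real q"
proof -
  have q: "q > 0" using assms(1) by (simp add: prime_gt_0_nat)
  interpret report_scheme q C n\<^sub>1 L "mds_word q k" "link_sum_key q C n\<^sub>1" Zr Zw adv m
    by unfold_locales (use q readable(1) in \<open>simp_all add: mds_word_less link_sum_key_def\<close>)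
  have "\<not> {..<C} \<subseteq> Zr"
  proof
    assume "{..<C} \<subseteq> Zr"
    then have "Zr = {..<C}" using readable(1) by (rule equalityI[rotated])
    then show False using readable(2) by simp
  qed
  then obtain b where b: "b < C" "b \<notin> Zr" by blast
  define A where "A = {xs :: nat list. set xs \<subseteq> {..<q} \<and> length xs = C * L}"
  define forged where "forged = (\<lambda>(d, i). {xs \<in> A. rep (to_nat xs) \<noteq> d \<and>
    rcv (to_nat xs) (Suc N) N i = link_sum_key q C n\<^sub>1 (rcv (to_nat xs) N) d})"
  let ?err = "{w. key_dec q C n\<^sub>1 N (mds_word q k) K (C - k) (rcv w (Suc N)) \<noteq> m}"
  have finA: "finite A" unfolding A_def by (intro finite_lists_length_eq) simp
  have cardA: "card A = q ^ (C * L)" unfolding A_def by (simp add: card_lists_length_eq)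
  have A_ne: "A \<noteq> {}" using cardA q by fastforce
  have card_forged: "real (card (forged (d, i))) \<le> real q ^ (C * L) / real q" if d: "d < L" "i < C" for d i
  proof -
    have pos: "d * C + b < C * L"
    proof -
      have "d * C + b < Suc d * C" using b by simp
      also have "\<dots> \<le> L * C" using d by (intro mult_right_mono) auto
      finally show ?thesis by (simp add: mult.commute)
    qed
    \<comment> \<open>Given the other key symbols, a forgery forces the symbol sent at time
      \<open>n\<^sub>1 + d\<close> on the unread link \<open>b\<close>.\<close>
    have "card (forged (d, i)) * q \<le> q ^ (C * L)"
    proof (rule card_determined_position_le[OF pos])
      show "length xs = C * L \<and> set xs \<subseteq> {..<q}" if "xs \<in> forged (d, i)" for xs
        using that unfolding forged_def A_def by auto
      fix xs ys assume xy: "xs \<in> forged (d, i)" "ys \<in> forged (d, i)"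
        and eq: "\<And>l. l \<noteq> d * C + b \<Longrightarrow> xs ! l = ys ! l"
      have lt: "zs ! (d * C + b) < q" if "zs \<in> forged (d, i)" for zs
      proof -
        have "set zs \<subseteq> {..<q}" "length zs = C * L" using that unfolding forged_def A_def by auto
        then have "zs ! (d * C + b) \<in> {..<q}" using pos nth_mem[of "d * C + b" zs] by (metis subsetD)
        then show ?thesis by simp
      qed
      show "xs ! (d * C + b) = ys ! (d * C + b)"
        by (rule key_symbol_determined[OF _ b d(1) lt[OF xy(1)] lt[OF xy(2)] eq _ d(2)])
          (use xy in \<open>auto simp: forged_def N_def link_sum_key_def\<close>)
    qed
    then have "real (card (forged (d, i))) * real q \<le> real q ^ (C * L)"
      by (metis of_nat_le_iff of_nat_mult of_nat_power)
    then show ?thesis using q by (simp add: field_simps)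
  qed
  have sub: "A \<inter> to_nat -` ?err \<subseteq> (\<Union>x\<in>{..<L} \<times> {..<C}. forged x)"
  proof
    fix xs assume xs: "xs \<in> A \<inter> to_nat -` ?err"
    have "\<exists>d<2 ^ C. \<exists>i<C. rep (to_nat xs) \<noteq> d \<and>
        rcv (to_nat xs) (Suc N) N i = link_sum_key q C n\<^sub>1 (rcv (to_nat xs) N) d"
    proof (rule ccontr)
      assume "\<not> ?thesis"
      then have "key_dec q C n\<^sub>1 N (mds_word q k) K (C - k) (rcv (to_nat xs) (Suc N)) = m"
        unfolding N_def
        by (intro key_dec_correct[OF assms(1-6) readable(1) Zw]) (auto simp: N_def)
      with xs show False by simp
    qed
    then show "xs \<in> (\<Union>x\<in>{..<L} \<times> {..<C}. forged x)"
      using xs unfolding forged_def L_def by auto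
  qed
  have "measure_pmf.prob (key_pmf q (C * L)) ?err = real (card (A \<inter> to_nat -` ?err)) / real (card A)"
    unfolding key_pmf_def A_def[symmetric] using finA A_ne by (simp add: measure_pmf_of_set)
  also have "\<dots> \<le> (real (C * L) * (real q ^ (C * L) / real q)) / real (card A)"
  proof (rule divide_right_mono)
    have "card (A \<inter> to_nat -` ?err) \<le> card (\<Union>x\<in>{..<L} \<times> {..<C}. forged x)"
      using sub finA by (intro card_mono) (auto simp: forged_def)
    also have "\<dots> \<le> (\<Sum>x\<in>{..<L} \<times> {..<C}. card (forged x))" by (intro card_UN_le) simp
    finally have "real (card (A \<inter> to_nat -` ?err)) \<le> (\<Sum>x\<in>{..<L} \<times> {..<C}. real (card (forged x)))"
      by (metis of_nat_le_iff of_nat_sum)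
    also have "\<dots> \<le> (\<Sum>x\<in>{..<L} \<times> {..<C}. real q ^ (C * L) / real q)"
      using card_forged by (intro sum_mono) auto
    finally show "real (card (A \<inter> to_nat -` ?err)) \<le> real (C * L) * (real q ^ (C * L) / real q)"
      by (simp add: card_cartesian_product mult.commute)
  qed simp
  also have "\<dots> = real (C * L) / real q" using cardA q by simp
  finally show ?thesis unfolding N_def .
qed

section \<open>Capacity\<close>

lemma message_count_pos: "q \<ge> 2 \<Longrightarrow> nat \<lceil>real q powr x\<rceil> > 0"
  by simp

text \<open>There is a single message, and the constant decoder 0 is always right.\<close>

lemma achievable_nonpos:
  assumes "R \<le> 0"
  shows "achievable C zrw zro zwo R"
  unfolding achievable_def
proof (intro allI impI)
  fix \<epsilon> :: real assume \<epsilon>: "\<epsilon> > 0"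
  have K: "nat \<lceil>real 2 powr (real n * R)\<rceil> = 1" for n
  proof -
    have "real 2 powr (real n * R) \<le> real 2 powr 0"
      using assms by (intro powr_mono) (auto simp: mult_nonneg_nonpos)
    moreover have "real 2 powr (real n * R) > 0" by simp
    ultimately have "\<lceil>real 2 powr (real n * R)\<rceil> = 1" by (intro ceiling_unique) auto
    then show ?thesis by simp
  qed
  have err: "err_prob 2 C n [n] (nat \<lceil>real 2 powr (real n * R)\<rceil>) enc (\<lambda>_. 0) W Zr Zw adv < \<epsilon>" for n enc W Zr Zw adv
    unfolding K err_prob_def using \<epsilon> by (simp add: lessThan_Suc)
  show "\<exists>N. \<forall>n\<ge>N. \<exists>q::nat. q \<ge> 2 \<and> (\<exists>ns enc dec W. ns \<noteq> [] \<and> sum_list ns = n \<and>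
      (\<forall>Zrw Zro Zwo adv. admissible_sets C zrw zro zwo Zrw Zro Zwo \<longrightarrow>
        err_prob q C n ns (nat \<lceil>real q powr (real n * R)\<rceil>) enc dec W (Zrw \<union> Zro) (Zrw \<union> Zwo) adv < \<epsilon>))"
  proof (rule exI[of _ 0], intro allI impI, rule exI[of _ 2], intro conjI)
    fix n
    show "\<exists>ns enc dec W. ns \<noteq> [] \<and> sum_list ns = n \<and>
      (\<forall>Zrw Zro Zwo adv. admissible_sets C zrw zro zwo Zrw Zro Zwo \<longrightarrow>
        err_prob 2 C n ns (nat \<lceil>real 2 powr (real n * R)\<rceil>) enc dec W (Zrw \<union> Zro) (Zrw \<union> Zwo) adv < \<epsilon>)"
      using err by (intro exI[of _ "[n]"] exI[of _ undefined] exI[of _ "\<lambda>_. 0"] conjI) simp_all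
  qed simp
qed

lemma err_prob_le:
  assumes "K > 0"
    and "\<And>m. m < K \<Longrightarrow> measure_pmf.prob W {w. dec (run q C enc ns Zr Zw adv m w n) \<noteq> m} \<le> c"
  shows "err_prob q C n ns K enc dec W Zr Zw adv \<le> c"
proof -
  have "(\<Sum>m<K. measure_pmf.prob W {w. dec (run q C enc ns Zr Zw adv m w n) \<noteq> m}) \<le> (\<Sum>m<K. c)"
    using assms(2) by (intro sum_mono) simp
  then show ?thesis using assms(1) unfolding err_prob_def by (simp add: field_simps)
qed

lemma admissible_card:
  assumes "admissible_sets C zrw zro zwo Zrw Zro Zwo"
  shows "Zrw \<union> Zro \<subseteq> {..<C}" "Zrw \<union> Zwo \<subseteq> {..<C}"
    "card (Zrw \<union> Zro) \<le> zrw + zro" "card (Zrw \<union> Zwo) \<le> zrw + zwo"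
  using assms card_Un_le[of Zrw Zro] card_Un_le[of Zrw Zwo] unfolding admissible_sets_def by auto

text \<open>Keys and report take \<open>L + 1\<close> steps whatever \<open>n\<close> is, so their
  cost in rate vanishes; a large prime \<open>q\<close> makes forgery unlikely.\<close>

lemma achievable_below:
  assumes z: "zrw + zro + zwo \<le> C" and not_sym: "\<not> (zrw + zro = C \<and> C \<le> 2 * (zrw + zwo))"
    and R: "R < real C - real (zrw + zwo)"
  shows "achievable C zrw zro zwo R"
proof (cases "R \<le> 0")
  case True
  then show ?thesis by (rule achievable_nonpos)
next
  case False
  define k where "k = C - (zrw + zwo)"
  have k: "k \<le> C" "zrw + zwo = C - k" "R < real k" using z R unfolding k_def by auto
  then have k0: "0 < k" using False by (cases k) auto
  define L :: nat where "L = 2 ^ C"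
  show ?thesis
    unfolding achievable_def
  proof (intro allI impI)
    fix \<epsilon> :: real assume \<epsilon>: "\<epsilon> > 0"
    \<comment> \<open>The first bound leaves room for keys and report; the second gives
      \<open>n * R \<le> k * n\<^sub>1\<close>, so that all messages fit into the payload.\<close>
    define N\<^sub>0 where "N\<^sub>0 = max (L + 1) (nat \<lceil>real k * real (L + 1) / (real k - R)\<rceil>)"
    show "\<exists>N. \<forall>n\<ge>N. \<exists>q::nat. q \<ge> 2 \<and> (\<exists>ns enc dec W. ns \<noteq> [] \<and> sum_list ns = n \<and>
      (\<forall>Zrw Zro Zwo adv. admissible_sets C zrw zro zwo Zrw Zro Zwo \<longrightarrow>
        err_prob q C n ns (nat \<lceil>real q powr (real n * R)\<rceil>) enc dec W (Zrw \<union> Zro) (Zrw \<union> Zwo) adv < \<epsilon>))"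
    proof (rule exI[of _ N\<^sub>0], intro allI impI)
      fix n assume n: "n \<ge> N\<^sub>0"
      define n\<^sub>1 where "n\<^sub>1 = n - (L + 1)"
      have n_eq: "n = Suc (n\<^sub>1 + L)" using n unfolding n\<^sub>1_def N\<^sub>0_def by simp
      have "real k * real (L + 1) / (real k - R) \<le> real n" using n unfolding N\<^sub>0_def by linarith
      then have rate: "real n * R \<le> real (k * n\<^sub>1)"
        using k(3) unfolding n_eq by (simp add: field_simps)
      \<comment> \<open>\<open>q > L\<close> leaves room for all reports and for distinct evaluation
        points; the other bound pushes the forgery probability below
        \<open>\<epsilon>\<close>.\<close>
      obtain q where q: "prime q" "q > max L (nat \<lceil>real (C * L) / \<epsilon>\<rceil>)" using bigger_prime by blast
      have q2: "q \<ge> 2" using q prime_ge_2_nat by blast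
      have qL: "2 ^ C \<le> q" using q unfolding L_def by simp
      then have qC: "C \<le> q" using less_exp[of C] by linarith
      have "real (C * L) / \<epsilon> < real q" using q(2) by linarith
      then have q\<epsilon>: "real (C * L) / real q < \<epsilon>" using \<epsilon> q2 by (simp add: field_simps)
      define K where "K = nat \<lceil>real q powr (real n * R)\<rceil>"
      have K0: "K > 0" unfolding K_def by (rule message_count_pos[OF q2])
      have K: "K \<le> q ^ (k * n\<^sub>1)"
      proof -
        have "real q powr (real n * R) \<le> real q powr real (k * n\<^sub>1)"
          using rate q2 by (intro powr_mono) auto
        also have "\<dots> = real (q ^ (k * n\<^sub>1))" using q2 by (subst powr_realpow) auto
        finally show ?thesis unfolding K_def by linarith
      qed
      let ?ns = "[n\<^sub>1 + L, Suc 0]"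
      have "\<exists>enc dec W. \<forall>Zrw Zro Zwo adv. admissible_sets C zrw zro zwo Zrw Zro Zwo \<longrightarrow>
          err_prob q C n ?ns K enc dec W (Zrw \<union> Zro) (Zrw \<union> Zwo) adv < \<epsilon>"
      \<comment> \<open>In the first case more than half of the links are unjammed; in the second,
        \<open>not_sym\<close> leaves an unread link.\<close>
      proof (cases "C < 2 * k")
        case True
        show ?thesis
        proof (intro exI allI impI)
          fix Zrw Zro Zwo adv assume "admissible_sets C zrw zro zwo Zrw Zro Zwo"
          note Z = admissible_card[OF this]
          have "err_prob q C n ?ns K (report_enc C n\<^sub>1 L (mds_word q k) (\<lambda>V d. d))
              (majority_dec C n\<^sub>1 (n\<^sub>1 + L) (mds_word q k) K (C - k)) (return_pmf 0)
              (Zrw \<union> Zro) (Zrw \<union> Zwo) adv \<le> 0"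
            using majority_dec_correct[OF q(1) qL _ K k(1) True Z(1,2)] Z(4) k(2)
            by (intro err_prob_le[OF K0]) (simp add: n_eq)
          then show "err_prob q C n ?ns K (report_enc C n\<^sub>1 L (mds_word q k) (\<lambda>V d. d))
              (majority_dec C n\<^sub>1 (n\<^sub>1 + L) (mds_word q k) K (C - k)) (return_pmf 0)
              (Zrw \<union> Zro) (Zrw \<union> Zwo) adv < \<epsilon>" using \<epsilon> by simp
        qed
      next
        case False
        then have zr: "zrw + zro < C" using not_sym z k by auto
        show ?thesis
        proof (intro exI allI impI)
          fix Zrw Zro Zwo adv assume "admissible_sets C zrw zro zwo Zrw Zro Zwo"
          note Z = admissible_card[OF this]
          have "err_prob q C n ?ns K (report_enc C n\<^sub>1 L (mds_word q k) (link_sum_key q C n\<^sub>1))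
              (key_dec q C n\<^sub>1 (n\<^sub>1 + L) (mds_word q k) K (C - k)) (key_pmf q (C * L))
              (Zrw \<union> Zro) (Zrw \<union> Zwo) adv \<le> real (C * L) / real q"
            using key_dec_error_le[OF q(1) qC _ K k(1) k0 Z(1) _ Z(2)] Z(3,4) zr k(2)
            unfolding n_eq L_def by (intro err_prob_le[OF K0]) simp
          then show "err_prob q C n ?ns K (report_enc C n\<^sub>1 L (mds_word q k) (link_sum_key q C n\<^sub>1))
              (key_dec q C n\<^sub>1 (n\<^sub>1 + L) (mds_word q k) K (C - k)) (key_pmf q (C * L))
              (Zrw \<union> Zro) (Zrw \<union> Zwo) adv < \<epsilon>" using q\<epsilon> by simp
        qed
      qed
      then obtain enc dec W where "\<forall>Zrw Zro Zwo adv. admissible_sets C zrw zro zwo Zrw Zro Zwo \<longrightarrow>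
          err_prob q C n ?ns K enc dec W (Zrw \<union> Zro) (Zrw \<union> Zwo) adv < \<epsilon>" by blast
      moreover have "?ns \<noteq> []" "sum_list ?ns = n" by (simp_all add: n_eq)
      ultimately show "\<exists>q::nat. q \<ge> 2 \<and> (\<exists>ns enc dec W. ns \<noteq> [] \<and> sum_list ns = n \<and>
        (\<forall>Zrw Zro Zwo adv. admissible_sets C zrw zro zwo Zrw Zro Zwo \<longrightarrow>
          err_prob q C n ns (nat \<lceil>real q powr (real n * R)\<rceil>) enc dec W (Zrw \<union> Zro) (Zrw \<union> Zwo) adv < \<epsilon>))"
        using q2 unfolding K_def by blast
    qed
  qed
qed

theorem theorem7:
  fixes C zrw zro zwo :: nat
  assumes "zrw + zro + zwo \<le> C"
  shows "capacity C zrw zro zwo =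
    (if zrw + zro = C \<and> C \<le> 2 * (zrw + zwo) then 0 else real C - real (zrw + zwo))"
proof (cases "zrw + zro = C \<and> C \<le> 2 * (zrw + zwo)")
  case True
  \<comment> \<open>Reading all links forces \<open>zwo = 0\<close>, so
    \<open>C \<le> 2 * zrw\<close>.\<close>
  then have "achievable C zrw zro zwo R \<Longrightarrow> R \<le> 0" for R
    using assms by (intro achievable_le_0_symmetrizable[of zrw zro C zwo R]) auto
  then have "{R. achievable C zrw zro zwo R} = {..0}" using achievable_nonpos by auto
  then show ?thesis using True by (simp add: capacity_def)
next
  case False
  let ?k = "real C - real (zrw + zwo)"
  have ub: "R \<le> ?k" if "achievable C zrw zro zwo R" for R
    using achievable_le_unjammed[of zrw zwo C zro R] that assms by simp
  have "Sup {R. achievable C zrw zro zwo R} = ?k"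
  proof (rule cSup_eq_non_empty)
    show "{R. achievable C zrw zro zwo R} \<noteq> {}" using achievable_nonpos[of 0 C zrw zro zwo] by blast
    show "x \<le> ?k" if "x \<in> {R. achievable C zrw zro zwo R}" for x using that ub by simp
    show "?k \<le> y" if "\<And>x. x \<in> {R. achievable C zrw zro zwo R} \<Longrightarrow> x \<le> y" for y
    \<comment> \<open>Achievability of all rates strictly below the bound suffices for the
      supremum.\<close>
    proof (rule dense_le)
      fix x assume "x < ?k"
      then have "achievable C zrw zro zwo x" by (rule achievable_below[OF assms False])
      then show "x \<le> y" using that by blast
    qed
  qed
  then show ?thesis unfolding capacity_def if_not_P[OF False] .
qed

end
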